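(* If $D$ is a finite, acyclic digraph with a unique source $\mathbf{0}$ and there is a U-coloring of the arcs of $D$, then the transitive closure of $D$ is an upper locally distributive lattice.
   Context: For a digraph $D=(V,A)$, an arc coloring $c$ is a U-coloring if for all $u,v,w\in V$ with $u\neq w$ and $(v,u),(v,w)\in A$: (U$_1$) $c(v,u)\neq c(v,w)$; (U$_2$) there is $z\in V$ with arcs $(u,z),(w,z)\in A$ such that $c(v,u)=c(w,z)$ and $c(v,w)=c(u,z)$. A poset $P$ is an upper locally distributive lattice if $P$ is a lattice and there is a map $x\mapsto M_x$ assigning to each $x\in P$ a set $M_x$ of meet-irreducible elements with $x=\bigwedge M_x$ and such that whenever $x=\bigwedge B$ for a set $B$ of meet-irreducibles then $M_x\subseteq B$. *)

theory Defs
  imports "Graph_Theory.Pair_Digraph" "HOL-Algebra.Lattice"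
begin

definition is_source :: "'a pair_pre_digraph \<Rightarrow> 'a \<Rightarrow> bool" where
  "is_source D s \<longleftrightarrow> s \<in> pverts D \<and> in_arcs (with_proj D) s = {}"

definition U_coloring :: "'a pair_pre_digraph \<Rightarrow> ('a \<times> 'a \<Rightarrow> 'c) \<Rightarrow> bool" where
  "U_coloring D c \<longleftrightarrow>
     (\<forall>u\<in>pverts D. \<forall>v\<in>pverts D. \<forall>w\<in>pverts D.
        u \<noteq> w \<and> (v, u) \<in> parcs D \<and> (v, w) \<in> parcs D \<longrightarrow>
          c (v, u) \<noteq> c (v, w) \<and>
          (\<exists>z\<in>pverts D. (u, z) \<in> parcs D \<and> (w, z) \<in> parcs D \<and>
             c (v, u) = c (w, z) \<and> c (v, w) = c (u, z)))"

text \<open>The closure is reflexive as well as transitive; \<^const>\<open>reachable\<close> contains the trivial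
  walks at vertices. Arcs point upwards, so a unique source of a finite acyclic digraph is the
  least element.\<close>

definition closure_order :: "'a pair_pre_digraph \<Rightarrow> 'a gorder" where
  "closure_order D = \<lparr>carrier = pverts D, eq = (=), le = reachable (with_proj D)\<rparr>"

text \<open>The greatest element is the meet of the empty set and does not count as meet-irreducible.\<close>

definition meet_irreducible :: "('a, 'b) gorder_scheme \<Rightarrow> 'a \<Rightarrow> bool" where
  "meet_irreducible L m \<longleftrightarrow>
     m \<in> carrier L \<and> \<not> greatest L m (carrier L) \<and>
     (\<forall>a\<in>carrier L. \<forall>b\<in>carrier L. m = a \<sqinter>\<^bsub>L\<^esub> b \<longrightarrow> m = a \<or> m = b)"

text \<open>\<open>x = \<And>B\<close> is rendered by \<open>is_glb L x B\<close>, because the infimum operator of the library is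
  unspecified when no greatest lower bound exists.\<close>

definition upper_locally_distributive_lattice :: "('a, 'b) gorder_scheme \<Rightarrow> bool" where
  "upper_locally_distributive_lattice L \<longleftrightarrow>
     lattice L \<and>
     (\<exists>M. \<forall>x\<in>carrier L.
        M x \<subseteq> Collect (meet_irreducible L) \<and> is_glb L x (M x) \<and>
        (\<forall>B\<subseteq>Collect (meet_irreducible L). is_glb L x B \<longrightarrow> M x \<subseteq> B))"

end

theory Submission
  imports Defs "HOL-Library.Multiset"
begin

text \<open>
  Condition U says that arcs of different colors leaving a vertex commute. Hence any two directed
  walks leaving a vertex can be completed to a common endpoint, each one only using the colors
  that the other has in excess, counted with multiplicity. By acyclicity, the multiset
  \<open>\<gamma> x\<close> of colors of a walk from the source to \<open>x\<close> depends on \<open>x\<close> only, and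
  \<open>\<gamma>\<close> embeds the reachability order into multisets ordered by inclusion, with an image closed
  under union. Closure under union gives joins, and finiteness with a least element gives meets.

  For an arc of color \<open>i\<close> leaving \<open>x\<close>, the elements \<open>y\<close> above \<open>x\<close> in which \<open>i\<close> has
  the same multiplicity as in \<open>x\<close> are closed under joins. The greatest such \<open>y\<close> is
  meet-irreducible, and the elements obtained in this way from all arcs leaving \<open>x\<close> form the
  set \<open>M\<^sub>x\<close>.
\<close>

section \<open>Orders embedded into multisets\<close>

lemma add_mset_subseteq_iff_count:
  assumes "A \<subseteq># B"
  shows "add_mset i A \<subseteq># B \<longleftrightarrow> count A i < count B i"
  using assms by (auto simp: subseteq_mset_def Suc_le_eq)

text \<open>Isolates what the lattice argument needs of the digraph. \<open>ex_step\<close> is the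
  trace left by the arcs: below any \<open>y\<close> strictly above \<open>x\<close> there is an
  element that gains a single color over \<open>x\<close>.\<close>

locale multiset_embedded_order =
  fixes V :: "'a set" and le :: "'a \<Rightarrow> 'a \<Rightarrow> bool" and \<gamma> :: "'a \<Rightarrow> 'c multiset"
  assumes finite_V: "finite V"
    and le_iff: "x \<in> V \<Longrightarrow> y \<in> V \<Longrightarrow> le x y \<longleftrightarrow> \<gamma> x \<subseteq># \<gamma> y"
    and inj: "inj_on \<gamma> V"
    and ex_empty: "\<exists>x\<in>V. \<gamma> x = {#}"
    and ex_union: "x \<in> V \<Longrightarrow> y \<in> V \<Longrightarrow> \<exists>z\<in>V. \<gamma> z = \<gamma> x \<union># \<gamma> y"
    and ex_step: "x \<in> V \<Longrightarrow> y \<in> V \<Longrightarrow> \<gamma> x \<subset># \<gamma> y \<Longrightarrow>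
      \<exists>u\<in>V. \<exists>i. \<gamma> u = add_mset i (\<gamma> x) \<and> \<gamma> u \<subseteq># \<gamma> y"
begin

section \<open>Lattice structure\<close>

definition L :: "'a gorder" where
  "L = \<lparr>carrier = V, eq = (=), le = le\<rparr>"

lemma L_simps [simp]: "carrier L = V" "eq L = (=)" "gorder.le L = le"
  by (simp_all add: L_def)

lemma le_eqI: "x \<in> V \<Longrightarrow> y \<in> V \<Longrightarrow> \<gamma> x \<subseteq># \<gamma> y \<Longrightarrow> \<gamma> y \<subseteq># \<gamma> x \<Longrightarrow> x = y"
  using inj by (meson inj_onD subset_mset.order_antisym)

text \<open>An element \<open>m\<close> of maximal size is greatest, since an upper bound in
  \<open>S\<close> of \<open>m\<close> and any \<open>a\<close> cannot be larger than
  \<open>m\<close> and so has the same multiset.\<close>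

lemma ex_greatest_of_directed:
  assumes "S \<subseteq> V" "S \<noteq> {}"
    and dir: "\<And>a b. a \<in> S \<Longrightarrow> b \<in> S \<Longrightarrow> \<exists>z\<in>S. \<gamma> a \<subseteq># \<gamma> z \<and> \<gamma> b \<subseteq># \<gamma> z"
  shows "\<exists>m\<in>S. \<forall>a\<in>S. \<gamma> a \<subseteq># \<gamma> m"
proof -
  have fin: "finite S" using assms(1) finite_V finite_subset by blast
  define k where "k = Max ((\<lambda>x. size (\<gamma> x)) ` S)"
  have "k \<in> (\<lambda>x. size (\<gamma> x)) ` S"
    unfolding k_def using fin assms(2) by (intro Max_in) auto
  then obtain m where m: "m \<in> S" "size (\<gamma> m) = k" by auto
  have mx: "size (\<gamma> a) \<le> k" if "a \<in> S" for a
    unfolding k_def using fin that by (intro Max_ge) auto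
  have "\<gamma> a \<subseteq># \<gamma> m" if a: "a \<in> S" for a
  proof -
    obtain z where z: "z \<in> S" "\<gamma> a \<subseteq># \<gamma> z" "\<gamma> m \<subseteq># \<gamma> z" using dir[OF a m(1)] by blast
    have "\<gamma> m = \<gamma> z"
      using z mx[OF z(1)] m(2) by (metis linorder_not_le mset_subset_size subset_mset.le_less)
    with z show ?thesis by simp
  qed
  with m show ?thesis by blast
qed

text \<open>The common lower bounds contain the bottom and are closed under union, so they have a
  greatest member. Its multiset need not be the intersection of \<open>\<gamma> x\<close> and
  \<open>\<gamma> y\<close>.\<close>

lemma ex_meet:
  assumes "x \<in> V" "y \<in> V"
  shows "\<exists>m\<in>V. \<gamma> m \<subseteq># \<gamma> x \<and> \<gamma> m \<subseteq># \<gamma> y \<and>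
    (\<forall>z\<in>V. \<gamma> z \<subseteq># \<gamma> x \<longrightarrow> \<gamma> z \<subseteq># \<gamma> y \<longrightarrow> \<gamma> z \<subseteq># \<gamma> m)"
proof -
  define S where "S = {z \<in> V. \<gamma> z \<subseteq># \<gamma> x \<and> \<gamma> z \<subseteq># \<gamma> y}"
  have "\<exists>m\<in>S. \<forall>a\<in>S. \<gamma> a \<subseteq># \<gamma> m"
  proof (rule ex_greatest_of_directed)
    show "S \<subseteq> V" by (auto simp: S_def)
    obtain z where "z \<in> V" "\<gamma> z = {#}" using ex_empty by blast
    then have "z \<in> S" by (simp add: S_def)
    then show "S \<noteq> {}" by blast
    fix a b assume ab: "a \<in> S" "b \<in> S"
    then obtain z where "z \<in> V" "\<gamma> z = \<gamma> a \<union># \<gamma> b" using ex_union by (auto simp: S_def)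
    with ab show "\<exists>z\<in>S. \<gamma> a \<subseteq># \<gamma> z \<and> \<gamma> b \<subseteq># \<gamma> z" by (auto simp: S_def)
  qed
  then show ?thesis by (auto simp: S_def)
qed

sublocale partial_order L
proof
  show "gorder.le L x z" if "gorder.le L x y" "gorder.le L y z"
    "x \<in> carrier L" "y \<in> carrier L" "z \<in> carrier L" for x y z
    using that by (auto simp: le_iff)
qed (auto simp: le_iff intro: le_eqI)

sublocale lattice L
proof
  show "\<exists>s. least L s (Upper L {x, y})" if xy: "x \<in> carrier L" "y \<in> carrier L" for x y
  proof -
    obtain z where "z \<in> V" "\<gamma> z = \<gamma> x \<union># \<gamma> y" using ex_union xy by auto
    with xy show ?thesis
      by (intro exI[of _ z]) (auto simp: least_def Upper_def le_iff)
  qed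
  show "\<exists>s. greatest L s (Lower L {x, y})" if xy: "x \<in> carrier L" "y \<in> carrier L" for x y
  proof -
    obtain m where "m \<in> V" "\<gamma> m \<subseteq># \<gamma> x" "\<gamma> m \<subseteq># \<gamma> y"
      "\<forall>z\<in>V. \<gamma> z \<subseteq># \<gamma> x \<longrightarrow> \<gamma> z \<subseteq># \<gamma> y \<longrightarrow> \<gamma> z \<subseteq># \<gamma> m"
      using ex_meet[of x y] xy unfolding L_simps by blast
    with xy show ?thesis
      by (intro exI[of _ m]) (auto simp: greatest_def Lower_def le_iff)
  qed
qed

lemma is_glb_iff:
  assumes "B \<subseteq> V"
  shows "is_glb L x B \<longleftrightarrow> x \<in> V \<and> (\<forall>b\<in>B. \<gamma> x \<subseteq># \<gamma> b) \<and>
    (\<forall>z\<in>V. (\<forall>b\<in>B. \<gamma> z \<subseteq># \<gamma> b) \<longrightarrow> \<gamma> z \<subseteq># \<gamma> x)"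
  using assms by (auto simp: greatest_def Lower_def le_iff subset_iff)

lemma meet_iff:
  assumes "a \<in> V" "b \<in> V"
  shows "m = a \<sqinter>\<^bsub>L\<^esub> b \<longleftrightarrow> m \<in> V \<and> \<gamma> m \<subseteq># \<gamma> a \<and> \<gamma> m \<subseteq># \<gamma> b \<and>
    (\<forall>z\<in>V. \<gamma> z \<subseteq># \<gamma> a \<longrightarrow> \<gamma> z \<subseteq># \<gamma> b \<longrightarrow> \<gamma> z \<subseteq># \<gamma> m)"  (is "_ \<longleftrightarrow> ?P m")
proof -
  have "a \<sqinter>\<^bsub>L\<^esub> b \<in> V" using meet_closed[of a b] assms by simp
  moreover from this have "?P (a \<sqinter>\<^bsub>L\<^esub> b)"
    using assms meet_left[of a b] meet_right[of a b] meet_le[of _ a b] by (auto simp: le_iff)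
  moreover have "m = m'" if "?P m" "?P m'" for m m'
    using that by (intro le_eqI) auto
  ultimately show ?thesis by blast
qed

section \<open>Meet-irreducible elements obtained from colors\<close>

definition colors_above :: "'a \<Rightarrow> 'c set" where
  "colors_above x = {i. \<exists>u\<in>V. \<gamma> u = add_mset i (\<gamma> x)}"

definition keeping :: "'a \<Rightarrow> 'c \<Rightarrow> 'a set" where
  "keeping x i = {y \<in> V. \<gamma> x \<subseteq># \<gamma> y \<and> count (\<gamma> y) i = count (\<gamma> x) i}"

definition top_keeping :: "'a \<Rightarrow> 'c \<Rightarrow> 'a" where
  "top_keeping x i = (SOME m. m \<in> keeping x i \<and> (\<forall>a\<in>keeping x i. \<gamma> a \<subseteq># \<gamma> m))"

text \<open>Multiplicities in a union are maxima, so a join of two members of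
  \<open>keeping x i\<close> has no more \<open>i\<close> than \<open>x\<close>; moreover
  \<open>x\<close> itself is a member.\<close>

lemma top_keeping:
  assumes "x \<in> V"
  shows "top_keeping x i \<in> keeping x i" "a \<in> keeping x i \<Longrightarrow> \<gamma> a \<subseteq># \<gamma> (top_keeping x i)"
proof -
  have "\<exists>m\<in>keeping x i. \<forall>a\<in>keeping x i. \<gamma> a \<subseteq># \<gamma> m"
  proof (rule ex_greatest_of_directed)
    show "keeping x i \<subseteq> V" by (auto simp: keeping_def)
    show "keeping x i \<noteq> {}" using assms by (auto simp: keeping_def)
    fix a b assume ab: "a \<in> keeping x i" "b \<in> keeping x i"
    then obtain z where z: "z \<in> V" "\<gamma> z = \<gamma> a \<union># \<gamma> b" using ex_union by (auto simp: keeping_def)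
    with ab have "z \<in> keeping x i"
      by (auto simp: keeping_def intro: subset_mset.le_supI1)
    with z show "\<exists>z\<in>keeping x i. \<gamma> a \<subseteq># \<gamma> z \<and> \<gamma> b \<subseteq># \<gamma> z"
      by (intro bexI[of _ z]) auto
  qed
  then have "\<exists>m. m \<in> keeping x i \<and> (\<forall>a\<in>keeping x i. \<gamma> a \<subseteq># \<gamma> m)" by blast
  from someI_ex[OF this, folded top_keeping_def]
  show "top_keeping x i \<in> keeping x i"
    "a \<in> keeping x i \<Longrightarrow> \<gamma> a \<subseteq># \<gamma> (top_keeping x i)" by blast+
qed

text \<open>Join \<open>y\<close> with the element one \<open>i\<close> above \<open>x\<close>:
  since \<open>y\<close> contains all of \<open>\<gamma> x\<close> and no further \<open>i\<close>,
  the join gains exactly one \<open>i\<close> over \<open>y\<close>.\<close>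

lemma colors_above_keeping:
  assumes "x \<in> V" "i \<in> colors_above x" "y \<in> keeping x i"
  obtains u where "u \<in> V" "\<gamma> u = add_mset i (\<gamma> y)"
proof -
  obtain v where v: "v \<in> V" "\<gamma> v = add_mset i (\<gamma> x)" using assms by (auto simp: colors_above_def)
  have y: "y \<in> V" "\<gamma> x \<subseteq># \<gamma> y" "count (\<gamma> y) i = count (\<gamma> x) i"
    using assms by (auto simp: keeping_def)
  obtain u where u: "u \<in> V" "\<gamma> u = \<gamma> y \<union># \<gamma> v" using ex_union y v by blast
  have "\<gamma> u = add_mset i (\<gamma> y)"
  proof (rule multiset_eqI)
    fix j
    show "count (\<gamma> u) j = count (add_mset i (\<gamma> y)) j"
      using y(3) mset_subset_eq_count[OF y(2), of j] by (auto simp: u v)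
  qed
  with u that show ?thesis by blast
qed

text \<open>All elements strictly above \<open>?m\<close> lie above one and the same
  \<open>u\<close>, which adds a single \<open>i\<close> to \<open>?m\<close>. Two of them therefore
  cannot have \<open>?m\<close> as their meet, and \<open>u\<close> shows that \<open>?m\<close> is
  not the greatest element.\<close>

lemma meet_irreducible_top_keeping:
  assumes x: "x \<in> V" and i: "i \<in> colors_above x"
  shows "meet_irreducible L (top_keeping x i)"
proof -
  let ?m = "top_keeping x i"
  have m: "?m \<in> keeping x i" using top_keeping x by blast
  then have mV: "?m \<in> V" and xm: "\<gamma> x \<subseteq># \<gamma> ?m" by (auto simp: keeping_def)
  obtain u where u: "u \<in> V" "\<gamma> u = add_mset i (\<gamma> ?m)"
    using colors_above_keeping[OF x i m] .
  have nu: "\<not> \<gamma> u \<subseteq># \<gamma> ?m" by (simp add: u add_mset_subseteq_iff_count)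
  have up: "\<gamma> u \<subseteq># \<gamma> a" if a: "a \<in> V" "\<gamma> ?m \<subseteq># \<gamma> a" "a \<noteq> ?m" for a
  proof -
    \<comment> \<open>By maximality of \<open>?m\<close>, whatever lies strictly above it has left
      \<open>keeping x i\<close>, which is possible only by gaining an \<open>i\<close>.\<close>
    have "a \<notin> keeping x i" using top_keeping(2)[OF x] le_eqI[OF a(1) mV] a by blast
    then have "count (\<gamma> a) i \<noteq> count (\<gamma> ?m) i"
      using a xm m by (auto simp: keeping_def)
    then have "count (\<gamma> ?m) i < count (\<gamma> a) i"
      using a by (metis mset_subset_eq_count le_neq_implies_less)
    with a show ?thesis by (simp add: u add_mset_subseteq_iff_count)
  qed
  show ?thesis
    unfolding meet_irreducible_def
  proof (intro conjI ballI impI)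
    show "?m \<in> carrier L" using mV by simp
    show "\<not> greatest L ?m (carrier L)" using nu u(1) mV by (auto simp: greatest_def le_iff)
    fix a b assume "a \<in> carrier L" "b \<in> carrier L" "?m = a \<sqinter>\<^bsub>L\<^esub> b"
    then have ab: "a \<in> V" "b \<in> V" "\<gamma> ?m \<subseteq># \<gamma> a" "\<gamma> ?m \<subseteq># \<gamma> b"
      "\<forall>z\<in>V. \<gamma> z \<subseteq># \<gamma> a \<longrightarrow> \<gamma> z \<subseteq># \<gamma> b \<longrightarrow> \<gamma> z \<subseteq># \<gamma> ?m"
      using meet_iff by auto
    with up nu u show "?m = a \<or> ?m = b" by blast
  qed
qed

text \<open>If a lower bound \<open>z\<close> were not below \<open>x\<close>, a step from
  \<open>x\<close> towards the join \<open>w\<close> of \<open>x\<close> and \<open>z\<close> would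
  gain some color \<open>i\<close>. But \<open>w\<close> lies below \<open>top_keeping x i\<close>,
  which has no more \<open>i\<close> than \<open>x\<close>.\<close>

lemma is_glb_top_keeping:
  assumes x: "x \<in> V"
  shows "is_glb L x (top_keeping x ` colors_above x)"
proof (subst is_glb_iff)
  show "top_keeping x ` colors_above x \<subseteq> V" using top_keeping(1)[OF x] by (auto simp: keeping_def)
  have "\<gamma> z \<subseteq># \<gamma> x" if z: "z \<in> V" "\<forall>i\<in>colors_above x. \<gamma> z \<subseteq># \<gamma> (top_keeping x i)" for z
  proof (rule ccontr)
    assume n: "\<not> \<gamma> z \<subseteq># \<gamma> x"
    obtain w where w: "w \<in> V" "\<gamma> w = \<gamma> x \<union># \<gamma> z" using ex_union x z by blast
    have "\<gamma> x \<subset># \<gamma> w" using n w by (metis subset_mset.le_iff_sup subset_mset.le_supE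
        subset_mset.order_refl subset_mset.le_less)
    then obtain u i where u: "u \<in> V" "\<gamma> u = add_mset i (\<gamma> x)" "\<gamma> u \<subseteq># \<gamma> w"
      using ex_step x w by blast
    then have i: "i \<in> colors_above x" by (auto simp: colors_above_def)
    have m: "top_keeping x i \<in> keeping x i" using top_keeping x by blast
    then have "\<gamma> w \<subseteq># \<gamma> (top_keeping x i)" using z i w by (auto simp: keeping_def)
    with u have "add_mset i (\<gamma> x) \<subseteq># \<gamma> (top_keeping x i)"
      by (metis subset_mset.order_trans)
    with m show False by (auto simp: keeping_def add_mset_subseteq_iff_count)
  qed
  then show "x \<in> V \<and> (\<forall>b\<in>top_keeping x ` colors_above x. \<gamma> x \<subseteq># \<gamma> b) \<and>
    (\<forall>z\<in>V. (\<forall>b\<in>top_keeping x ` colors_above x. \<gamma> z \<subseteq># \<gamma> b) \<longrightarrow> \<gamma> z \<subseteq># \<gamma> x)"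
    using x top_keeping(1)[OF x] by (auto simp: keeping_def)
qed

text \<open>The element \<open>v\<close> one \<open>i\<close> above \<open>x\<close> is not a lower
  bound of \<open>B\<close>, so some \<open>b\<close> in \<open>B\<close> is not above
  \<open>v\<close> and thus has no more \<open>i\<close> than \<open>x\<close>. Irreducibility
  forces this \<open>b\<close> to be \<open>?m\<close>.\<close>

lemma top_keeping_mem_of_is_glb:
  assumes x: "x \<in> V" and i: "i \<in> colors_above x"
    and B: "B \<subseteq> Collect (meet_irreducible L)" and glb: "is_glb L x B"
  shows "top_keeping x i \<in> B"
proof -
  let ?m = "top_keeping x i"
  have m: "?m \<in> keeping x i" using top_keeping x by blast
  have BV: "B \<subseteq> V" using B by (auto simp: meet_irreducible_def)
  obtain v where v: "v \<in> V" "\<gamma> v = add_mset i (\<gamma> x)" using i by (auto simp: colors_above_def)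
  have "\<not> \<gamma> v \<subseteq># \<gamma> x" by (simp add: v add_mset_subseteq_iff_count)
  then obtain b where b: "b \<in> B" "\<gamma> x \<subseteq># \<gamma> b" "\<not> \<gamma> v \<subseteq># \<gamma> b"
    using glb is_glb_iff[OF BV] v by blast
  have "count (\<gamma> b) i = count (\<gamma> x) i"
    using b mset_subset_eq_count[OF b(2), of i] by (auto simp: v add_mset_subseteq_iff_count)
  then have bk: "b \<in> keeping x i" using b BV by (auto simp: keeping_def)
  obtain b' where b': "b' \<in> V" "\<gamma> b' = add_mset i (\<gamma> b)"
    using colors_above_keeping[OF x i bk] .
  \<comment> \<open>\<open>b'\<close> exceeds \<open>b\<close> only in the color \<open>i\<close>,
    where \<open>?m\<close> agrees with \<open>b\<close>; so a common lower bound of both is below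
    \<open>b\<close> in every color.\<close>
  have "b = b' \<sqinter>\<^bsub>L\<^esub> ?m"
  proof (subst meet_iff)
    show "b' \<in> V" "?m \<in> V" using b' m by (auto simp: keeping_def)
    have "\<gamma> z \<subseteq># \<gamma> b" if "\<gamma> z \<subseteq># \<gamma> b'" "\<gamma> z \<subseteq># \<gamma> ?m" for z
      unfolding subseteq_mset_def
    proof
      fix j
      show "count (\<gamma> z) j \<le> count (\<gamma> b) j"
        using that bk m b'(2) mset_subset_eq_count[OF that(1), of j]
          mset_subset_eq_count[OF that(2), of j]
        by (cases "j = i") (auto simp: keeping_def)
    qed
    moreover have "\<gamma> b \<subseteq># \<gamma> ?m" using top_keeping(2)[OF x bk] .
    ultimately show "b \<in> V \<and> \<gamma> b \<subseteq># \<gamma> b' \<and> \<gamma> b \<subseteq># \<gamma> ?m \<and>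
      (\<forall>z\<in>V. \<gamma> z \<subseteq># \<gamma> b' \<longrightarrow> \<gamma> z \<subseteq># \<gamma> ?m \<longrightarrow> \<gamma> z \<subseteq># \<gamma> b)"
      using b BV b' by auto
  qed
  moreover have "meet_irreducible L b" using b B by blast
  ultimately have "b = b' \<or> b = ?m"
    using b' m by (auto simp: meet_irreducible_def keeping_def)
  moreover have "b \<noteq> b'" using b' by auto
  ultimately show ?thesis using b by blast
qed

theorem upper_locally_distributive: "upper_locally_distributive_lattice L"
  unfolding upper_locally_distributive_lattice_def
proof (intro conjI exI[of _ "\<lambda>x. top_keeping x ` colors_above x"] ballI allI impI)
  show "lattice L" by (rule lattice_axioms)
next
  fix x assume "x \<in> carrier L"
  then have x: "x \<in> V" by simp
  show "top_keeping x ` colors_above x \<subseteq> Collect (meet_irreducible L)"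
    using meet_irreducible_top_keeping[OF x] by blast
  show "is_glb L x (top_keeping x ` colors_above x)" by (rule is_glb_top_keeping[OF x])
  show "top_keeping x ` colors_above x \<subseteq> B"
    if "B \<subseteq> Collect (meet_irreducible L)" "is_glb L x B" for B
    using top_keeping_mem_of_is_glb[OF x _ that] by blast
qed

end

section \<open>Colored walks\<close>

text \<open>Only the multiset of colors along a walk matters, so the colors are not recorded as a
  list.\<close>

inductive colored_walk :: "'a rel \<Rightarrow> ('a \<times> 'a \<Rightarrow> 'c) \<Rightarrow> 'a \<Rightarrow> 'c multiset \<Rightarrow> 'a \<Rightarrow> bool"
  for E :: "'a rel" and c :: "'a \<times> 'a \<Rightarrow> 'c" where
  Nil: "colored_walk E c v {#} v"
| Cons: "(v, u) \<in> E \<Longrightarrow> colored_walk E c u A x \<Longrightarrow>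
    colored_walk E c v (add_mset (c (v, u)) A) x"

lemma colored_walk_append:
  assumes "colored_walk E c v A x" "colored_walk E c x B y"
  shows "colored_walk E c v (A + B) y"
  using assms by induction (simp_all add: colored_walk.Cons)

lemma colored_walk_imp_rtrancl: "colored_walk E c v A x \<Longrightarrow> (v, x) \<in> E\<^sup>*"
  by (induction rule: colored_walk.induct) (auto intro: converse_rtrancl_into_rtrancl)

lemma rtrancl_imp_colored_walk: "(v, x) \<in> E\<^sup>* \<Longrightarrow> \<exists>A. colored_walk E c v A x"
  by (induction rule: converse_rtrancl_induct) (blast intro: colored_walk.intros)+

lemma colored_walk_empty: "colored_walk E c v {#} x \<longleftrightarrow> x = v"
  by (subst colored_walk.simps) auto

locale u_colored_relation =
  fixes E :: "'a rel" and c :: "'a \<times> 'a \<Rightarrow> 'c"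
  assumes finite_E: "finite E" and acyclic_E: "acyclic E"
    and color_neq: "(v, u) \<in> E \<Longrightarrow> (v, w) \<in> E \<Longrightarrow> u \<noteq> w \<Longrightarrow> c (v, u) \<noteq> c (v, w)"
    and diamond: "(v, u) \<in> E \<Longrightarrow> (v, w) \<in> E \<Longrightarrow> u \<noteq> w \<Longrightarrow>
      \<exists>z. (u, z) \<in> E \<and> (w, z) \<in> E \<and> c (v, u) = c (w, z) \<and> c (v, w) = c (u, z)"
begin

section \<open>Transporting arcs along walks\<close>

abbreviation walk :: "'a \<Rightarrow> 'c multiset \<Rightarrow> 'a \<Rightarrow> bool" where
  "walk \<equiv> colored_walk E c"

text \<open>Amounts to moving an arc of the given color to the front of the walk. If the walk starts
  with another arc, to \<open>w\<close>, the diamond supplies an arc \<open>(w, z)\<close> of the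
  given color; it is removed from the rest by induction, and \<open>(u, z)\<close> takes over the
  color of the first arc.\<close>

lemma walk_remove_color:
  assumes "walk v A x" "(v, u) \<in> E" "c (v, u) \<in># A"
  shows "walk u (A - {#c (v, u)#}) x"
  using assms
proof (induction arbitrary: u rule: colored_walk.induct)
  case (Cons v w A x)
  show ?case
  proof (cases "u = w")
    case False
    obtain z where z: "(u, z) \<in> E" "(w, z) \<in> E" "c (v, u) = c (w, z)" "c (v, w) = c (u, z)"
      using diamond[OF Cons.prems(1) Cons.hyps(1) False] by blast
    have ne: "c (v, u) \<noteq> c (v, w)" using color_neq Cons False by blast
    with Cons.prems z have "c (w, z) \<in># A" by auto
    then have "walk z (A - {#c (w, z)#}) x" using Cons.IH z by blast
    then have "walk u (add_mset (c (u, z)) (A - {#c (w, z)#})) x"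
      by (rule colored_walk.Cons[OF z(1)])
    \<comment> \<open>The two colors differ, so adding one commutes with removing the other.\<close>
    with ne z show ?thesis by simp
  qed (use Cons in simp)
qed simp

text \<open>The arc is carried through one diamond per arc of the walk, keeping its color. As this
  color is absent from \<open>A\<close>, the carried arc never coincides with the next arc of the
  walk, so each diamond exists.\<close>

lemma walk_push_color:
  assumes "walk v A x" "(v, u) \<in> E" "c (v, u) \<notin># A"
  shows "\<exists>y. (x, y) \<in> E \<and> c (x, y) = c (v, u) \<and> walk u A y"
  using assms
proof (induction arbitrary: u rule: colored_walk.induct)
  case (Cons v w A x)
  then have "u \<noteq> w" by auto
  then obtain z where z: "(u, z) \<in> E" "(w, z) \<in> E" "c (v, u) = c (w, z)" "c (v, w) = c (u, z)"
    using diamond[OF Cons.prems(1) Cons.hyps(1)] by blast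
  have "c (w, z) \<notin># A" using Cons.prems z by auto
  then obtain y where "(x, y) \<in> E" "c (x, y) = c (w, z)" "walk z A y" using Cons.IH z by blast
  with z show ?case by (auto intro: colored_walk.Cons)
qed (auto intro: colored_walk.Nil)

text \<open>The first arc of the first walk is either cancelled against an arc of its color in the
  second walk, or pushed along the second walk to extend it beyond \<open>y\<close>. The exact
  differences make the color multiset of the common endpoint a union.\<close>

lemma walk_merge:
  assumes "walk v A x" "walk v B y"
  shows "\<exists>z. walk x (B - A) z \<and> walk y (A - B) z"
  using assms
proof (induction arbitrary: B y rule: colored_walk.induct)
  case (Nil v)
  then show ?case using colored_walk.Nil[of E c y] by auto
next
  case (Cons v u A x)
  let ?i = "c (v, u)"
  show ?case
  proof (cases "?i \<in># B")
    case True
    then have "walk u (B - {#?i#}) y" using walk_remove_color Cons by blast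
    then obtain z where "walk x (B - {#?i#} - A) z" "walk y (A - (B - {#?i#})) z"
      using Cons.IH by blast
    moreover have "add_mset ?i A - B = A - (B - {#?i#})"
      using True by (metis add_mset_diff_bothsides insert_DiffM)
    ultimately show ?thesis by auto
  next
    case False
    then obtain y' where y': "(y, y') \<in> E" "c (y, y') = ?i" "walk u B y'"
      using walk_push_color Cons by blast
    then obtain z where z: "walk x (B - A) z" "walk y' (A - B) z"
      using Cons.IH by blast
    from y' z(2) have "walk y (add_mset ?i (A - B)) z" by (metis colored_walk.Cons)
    moreover have "add_mset ?i A - B = add_mset ?i (A - B)" "B - add_mset ?i A = B - A"
      using False by (auto simp: multiset_eq_iff not_in_iff)
    ultimately show ?thesis using z by auto
  qed
qed

section \<open>Colors determined by the endpoints\<close>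

lemma walk_closed_empty:
  assumes "walk v A v"
  shows "A = {#}"
  using assms
proof cases
  case (Cons u B)
  then have "(v, v) \<in> E\<^sup>+"
    using colored_walk_imp_rtrancl[of E c u B v] by (meson rtrancl_into_trancl2)
  with acyclic_E show ?thesis by (auto simp: acyclic_def)
qed

text \<open>Compare both walks from the first vertex \<open>u\<close> after \<open>v\<close>. If the
  color of the arc to \<open>u\<close> occurs in \<open>B\<close>, remove it there. Otherwise push
  the arc along the second walk to some \<open>y\<close>: then \<open>B\<close> and
  \<open>A'\<close> with that color added both lead from \<open>u\<close> to \<open>y\<close>, so
  the color occurs in \<open>B\<close> after all.\<close>

lemma walk_colors_unique:
  assumes "walk v A x" "walk v B x"
  shows "A = B"
proof -
  \<comment> \<open>With the converse relation, the induction hypothesis speaks of the successors of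
    \<open>v\<close>.\<close>
  have "wf (E\<inverse>)" using finite_E acyclic_E by (simp add: finite_acyclic_wf_converse)
  then show ?thesis using assms
  proof (induction v arbitrary: A B x rule: wf_induct_rule)
    case (less v)
    from less.prems(1) show ?case
    proof cases
      case Nil
      then show ?thesis using less.prems walk_closed_empty by auto
    next
      case (Cons u A')
      let ?i = "c (v, u)"
      have IH: "P = Q" if "walk u P x'" "walk u Q x'" for P Q x'
        using less.IH[of u P x' Q] that Cons by auto
      show ?thesis
      proof (cases "?i \<in># B")
        case True
        then have "walk u (B - {#?i#}) x" using walk_remove_color less.prems Cons by blast
        with Cons IH have "A' = B - {#?i#}" by blast
        with Cons True show ?thesis by simp
      next
        case False
        then obtain y where y: "(x, y) \<in> E" "c (x, y) = ?i" "walk u B y"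
          using walk_push_color less.prems Cons by blast
        have "walk x {#?i#} y" using y by (metis colored_walk.intros)
        then have "walk u (A' + {#?i#}) y" using colored_walk_append[OF Cons(3)] by blast
        with y IH have "A' + {#?i#} = B" by blast
        with False show ?thesis by auto
      qed
    qed
  qed
qed

end

section \<open>Embedding a U-colored digraph into multisets\<close>

theorem theorem3:
  fixes D :: "'a pair_pre_digraph" and c :: "'a \<times> 'a \<Rightarrow> 'c"
  assumes "pair_fin_digraph D"
    and "acyclic (parcs D)"
    and "\<exists>!s. is_source D s"
    and "U_coloring D c"
  shows "upper_locally_distributive_lattice (closure_order D)"
proof -
  interpret G: pair_fin_digraph D by fact
  interpret u_colored_relation "parcs D" c
  proof
    show "finite (parcs D)" by (rule G.pair_finite_arcs)
    show "acyclic (parcs D)" by fact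
  next
    fix v u w assume *: "(v, u) \<in> parcs D" "(v, w) \<in> parcs D" "u \<noteq> w"
    then have "u \<in> pverts D" "v \<in> pverts D" "w \<in> pverts D" by (auto dest: G.wellformed')
    with * assms(4) show "c (v, u) \<noteq> c (v, w)"
      "\<exists>z. (u, z) \<in> parcs D \<and> (w, z) \<in> parcs D \<and> c (v, u) = c (w, z) \<and> c (v, w) = c (u, z)"
      unfolding U_coloring_def by blast+
  qed
  obtain s where s: "is_source D s" "\<And>v. is_source D v \<Longrightarrow> v = s" using assms(3) by blast
  have sV: "s \<in> pverts D" using s(1) by (simp add: is_source_def)
  have "wf (parcs D)" using finite_E acyclic_E by (rule finite_acyclic_wf)
  \<comment> \<open>Going backwards along arcs must end, and it can only end in the unique
    source.\<close>
  then have from_s: "v \<in> pverts D \<Longrightarrow> (s, v) \<in> (parcs D)\<^sup>*" for v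
  proof (induction v rule: wf_induct_rule)
    case (less v)
    show ?case
    proof (cases "v = s")
      case False
      then have "\<not> is_source D v" using s by blast
      then obtain u where "(u, v) \<in> parcs D" using less.prems by (auto simp: is_source_def)
      then show ?thesis using less.IH by (auto dest: G.wellformed' intro: rtrancl_into_rtrancl)
    qed simp
  qed
  define \<gamma> where "\<gamma> x = (THE A. walk s A x)" for x
  have \<gamma>_eq: "\<gamma> x = A" if "walk s A x" for A x
    unfolding \<gamma>_def using that walk_colors_unique by (intro the_equality) auto
  have walk_\<gamma>: "walk s (\<gamma> x) x" if "x \<in> pverts D" for x
    using rtrancl_imp_colored_walk[OF from_s[OF that]] \<gamma>_eq by blast
  have \<gamma>_walk: "\<gamma> y = \<gamma> x + B" if "x \<in> pverts D" "walk x B y" for x y B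
    by (rule \<gamma>_eq[OF colored_walk_append[OF walk_\<gamma>[OF that(1)] that(2)]])
  have walk_V: "y \<in> pverts D" if "x \<in> pverts D" "walk x B y" for x y B
    using that(2,1) by induction (auto dest: G.wellformed')
  have walk_diff: "walk x (\<gamma> y - \<gamma> x) y"
    if "x \<in> pverts D" "y \<in> pverts D" "\<gamma> x \<subseteq># \<gamma> y" for x y
  proof -
    \<comment> \<open>The merge adds nothing after \<open>y\<close>, so the common endpoint is
      \<open>y\<close> itself.\<close>
    have "\<gamma> x - \<gamma> y = {#}" using that(3) by (simp add: Diff_eq_empty_iff_mset)
    with walk_merge[OF walk_\<gamma>[OF that(1)] walk_\<gamma>[OF that(2)]] show ?thesis
      by (auto simp: colored_walk_empty)
  qed
  interpret multiset_embedded_order "pverts D" "reachable (with_proj D)" \<gamma>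
  proof
    show "finite (pverts D)" by (rule G.pair_finite_verts)
    show "\<exists>x\<in>pverts D. \<gamma> x = {#}"
      by (rule bexI[of _ s], rule \<gamma>_eq, rule colored_walk.Nil, rule sV)
    show "inj_on \<gamma> (pverts D)"
    proof (rule inj_onI)
      fix x y assume "x \<in> pverts D" "y \<in> pverts D" "\<gamma> x = \<gamma> y"
      with walk_diff[of x y] show "x = y" by (simp add: colored_walk_empty)
    qed
  next
    fix x y assume V: "x \<in> pverts D" "y \<in> pverts D"
    have "reachable (with_proj D) x y \<longleftrightarrow> (x, y) \<in> (parcs D)\<^sup>*"
      using V by (simp add: G.reachable_conv)
    also have "\<dots> \<longleftrightarrow> \<gamma> x \<subseteq># \<gamma> y"
    proof
      assume "(x, y) \<in> (parcs D)\<^sup>*"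
      from rtrancl_imp_colored_walk[OF this] obtain B where "walk x B y" ..
      from \<gamma>_walk[OF V(1) this] show "\<gamma> x \<subseteq># \<gamma> y" by simp
    next
      assume "\<gamma> x \<subseteq># \<gamma> y"
      from walk_diff[OF V this] show "(x, y) \<in> (parcs D)\<^sup>*" by (rule colored_walk_imp_rtrancl)
    qed
    finally show "reachable (with_proj D) x y \<longleftrightarrow> \<gamma> x \<subseteq># \<gamma> y" .
    \<comment> \<open>Merging walks from \<open>s\<close> to \<open>x\<close> and to
      \<open>y\<close> extends \<open>x\<close> by just the colors that \<open>y\<close> has in
      excess, which yields the union.\<close>
    obtain z where z: "walk x (\<gamma> y - \<gamma> x) z"
      using walk_merge[OF walk_\<gamma>[OF V(1)] walk_\<gamma>[OF V(2)]] by blast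
    have "\<gamma> z = \<gamma> x \<union># \<gamma> y" using \<gamma>_walk[OF V(1) z] by (simp add: union_mset_def)
    with walk_V[OF V(1) z] show "\<exists>z\<in>pverts D. \<gamma> z = \<gamma> x \<union># \<gamma> y" by blast
    assume less: "\<gamma> x \<subset># \<gamma> y"
    \<comment> \<open>The walk from \<open>x\<close> to \<open>y\<close> is nonempty because the
      inclusion is strict; the head of its first arc is the required \<open>u\<close>.\<close>
    from walk_diff[OF V subset_mset.less_imp_le[OF this]]
    show "\<exists>u\<in>pverts D. \<exists>i. \<gamma> u = add_mset i (\<gamma> x) \<and> \<gamma> u \<subseteq># \<gamma> y"
    proof cases
      case Nil
      with less show ?thesis by simp
    next
      case (Cons u A)
      then have u: "u \<in> pverts D" by (auto dest: G.wellformed')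
      have "walk x {#c (x, u)#} u" using Cons(2) by (auto intro: colored_walk.intros)
      from \<gamma>_walk[OF V(1) this] have "\<gamma> u = add_mset (c (x, u)) (\<gamma> x)" by simp
      moreover have "\<gamma> u \<subseteq># \<gamma> y" using \<gamma>_walk[OF u Cons(3)] by simp
      ultimately show ?thesis using u by blast
    qed
  qed
  show ?thesis using upper_locally_distributive by (simp add: L_def closure_order_def)
qed

end
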